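(* Let $\{s_n\}_{n\ge1}$ be a sequence of positive integers tending to infinity with $s_n\ge3$ for all $n\ge1$. Then for any positive number $N\ge2$, $$\dim\{x\in[0,1):s_n\le a_n(x)<Ns_n\ \ \forall n\ge1\}=\liminf_{n\to\infty}\frac{\log(s_1s_2\cdots s_n)}{2\log(s_1s_2\cdots s_n)+\log s_{n+1}}.$$
   Context: $a_n(x)$ denotes the $n$-th partial quotient of the continued fraction expansion of an irrational $x\in[0,1)$, and $\dim$ denotes Hausdorff dimension. *)

theory Defs
  imports "HOL-Analysis.Analysis"
begin

section \<open>Hausdorff measure and dimension\<close>

text \<open>
  The summand \<open>|U|\<^sup>s\<close> of the Hausdorff sums, with the usual conventions \<open>|{}|\<^sup>s = 0\<close> and
  \<open>|U|\<^sup>0 = 1\<close> for nonempty \<open>U\<close>.  The case \<open>s = 0\<close> is separate because \<open>0 powr 0 = 0\<close>.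
\<close>

definition diam_powr :: "real \<Rightarrow> 'a::metric_space set \<Rightarrow> ennreal" where
  "diam_powr s U =
     (if U = {} then 0 else if s = 0 then 1 else ennreal (diameter U powr s))"

text \<open>Boundedness is required because \<open>diameter\<close> is only meaningful on bounded sets.\<close>

definition delta_covers :: "real \<Rightarrow> 'a::metric_space set \<Rightarrow> (nat \<Rightarrow> 'a set) set" where
  "delta_covers \<delta> E =
     {U. E \<subseteq> (\<Union>i. U i) \<and> (\<forall>i. bounded (U i) \<and> diameter (U i) \<le> \<delta>)}"

definition hausdorff_premeasure :: "real \<Rightarrow> real \<Rightarrow> 'a::metric_space set \<Rightarrow> ennreal" where
  "hausdorff_premeasure s \<delta> E = (INF U\<in>delta_covers \<delta> E. \<Sum>i. diam_powr s (U i))"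

definition hausdorff_measure :: "real \<Rightarrow> 'a::metric_space set \<Rightarrow> ennreal" where
  "hausdorff_measure s E = (SUP \<delta>\<in>{0<..}. hausdorff_premeasure s \<delta> E)"

definition hausdorff_dim :: "'a::metric_space set \<Rightarrow> ereal" where
  "hausdorff_dim E = (INF s\<in>{s. 0 \<le> s \<and> hausdorff_measure s E = 0}. ereal s)"

section \<open>Continued fractions\<close>

definition gauss_map :: "real \<Rightarrow> real" where
  "gauss_map x = frac (1 / x)"

text \<open>
  \<open>partial_quotient n x\<close> is \<open>a\<^sub>n(x)\<close> for \<open>n \<ge> 1\<close> and irrational \<open>x\<close> in \<open>[0,1)\<close>:
  as \<open>x = 1 / (a\<^sub>1(x) + gauss_map x)\<close>, iterating yields \<open>x = [0; a\<^sub>1(x), a\<^sub>2(x), \<dots>]\<close>.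
  The value at \<open>n = 0\<close> (that at \<open>n = 1\<close>, by truncated subtraction) and the values at
  rational \<open>x\<close> have no meaning.
\<close>

definition partial_quotient :: "nat \<Rightarrow> real \<Rightarrow> int" where
  "partial_quotient n x = \<lfloor>1 / (gauss_map ^^ (n - 1)) x\<rfloor>"

end

theory Submission
  imports Defs
begin

text \<open>
  Let \<open>G\<close> be the Gauss map and \<open>P\<^sub>n = s\<^sub>1 \<dots> s\<^sub>n\<close>. If \<open>x\<close> and \<open>y\<close> share their first \<open>n\<close> digits, then
  \<open>\<bar>x - y\<bar> = \<bar>G\<^sup>n x - G\<^sup>n y\<bar> \<Prod>\<^sub>k\<^sub><\<^sub>n G\<^sup>k x G\<^sup>k y\<close>, and \<open>G\<^sup>k x\<close> is comparable to \<open>1 / s\<^sub>k\<^sub>+\<^sub>1\<close>.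

  Upper bound: at most \<open>N\<^sup>n P\<^sub>n\<close> digit blocks of length \<open>n\<close> occur, and as the next digit is at least
  \<open>s\<^sub>n\<^sub>+\<^sub>1\<close>, each of them spans a set of diameter at most \<open>1 / (P\<^sub>n\<^sup>2 s\<^sub>n\<^sub>+\<^sub>1)\<close>. The factor \<open>N\<^sup>n\<close> does not
  matter, since \<open>log P\<^sub>n\<close> grows faster than any multiple of \<open>n\<close>.

  Lower bound: let \<open>z\<close> in \<open>[0,1)\<close> have the digits \<open>d\<^sub>k < s\<^sub>k\<close> in the mixed radix system with bases \<open>s\<^sub>k\<close>, and
  map it to the continued fraction with the digits \<open>s\<^sub>k + d\<^sub>k\<close>. If \<open>z\<close> and \<open>w\<close> first differ at the digit \<open>n + 1\<close>,
  by \<open>j\<close>, then \<open>\<bar>z - w\<bar> \<le> 2 j / P\<^sub>n\<^sub>+\<^sub>1\<close>, whereas their images have distance at least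
  \<open>j / (6 \<cdot> 4\<^sup>n P\<^sub>n\<^sub>+\<^sub>1\<^sup>2)\<close>. So the inverse map is Hoelder continuous with every exponent \<open>t\<close> below the
  lower limit, and as its range has Lebesgue measure 1, the \<open>t\<close>-dimensional measure is positive.
\<close>

section \<open>Hausdorff measure\<close>

lemma hausdorff_premeasure_le_finite_cover:
  fixes V :: "'i \<Rightarrow> 'a::metric_space set"
  assumes I: "finite I" and cov: "E \<subseteq> (\<Union>i\<in>I. V i)" and t: "t > 0" and d: "0 \<le> d" "d \<le> \<delta>"
    and V: "\<And>i x y. i \<in> I \<Longrightarrow> x \<in> V i \<Longrightarrow> y \<in> V i \<Longrightarrow> dist x y \<le> d"
  shows "hausdorff_premeasure t \<delta> E \<le> ennreal (real (card I) * d powr t)"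
proof -
  obtain e where e: "bij_betw e {0..<card I} I"
    using ex_bij_betw_nat_finite[OF I] by blast
  define U where "U = (\<lambda>j. if j < card I then V (e j) else {})"
  have eI: "e j \<in> I" if "j < card I" for j
    using e that by (auto simp: bij_betw_def)
  have bd: "bounded (U j)" for j
  proof (cases "j < card I \<and> V (e j) \<noteq> {}")
    case True
    then obtain x where x: "x \<in> V (e j)" by auto
    show ?thesis
      unfolding bounded_def U_def using V[OF eI x] True by auto
  qed (auto simp: U_def)
  have dm: "diameter (U j) \<le> d" for j
    using d V[OF eI] by (auto simp: U_def diameter_def intro!: cSUP_least)
  have "E \<subseteq> (\<Union>j. U j)"
  proof
    fix x assume "x \<in> E"
    then obtain i where i: "i \<in> I" "x \<in> V i" using cov by auto
    then obtain j where "j < card I" "e j = i"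
      using e by (auto simp: bij_betw_def image_iff) (metis atLeastLessThan_iff imageE)
    then show "x \<in> (\<Union>j. U j)" using i by (auto simp: U_def)
  qed
  then have "U \<in> delta_covers \<delta> E"
    using bd dm d by (auto simp: delta_covers_def intro: order_trans)
  then have "hausdorff_premeasure t \<delta> E \<le> (\<Sum>j. diam_powr t (U j))"
    unfolding hausdorff_premeasure_def by (rule INF_lower)
  also have "\<dots> = (\<Sum>j<card I. diam_powr t (U j))"
    by (rule suminf_finite) (auto simp: U_def diam_powr_def)
  also have "\<dots> \<le> (\<Sum>j<card I. ennreal (d powr t))"
  proof (rule sum_mono)
    fix j
    show "diam_powr t (U j) \<le> ennreal (d powr t)"
      using t dm[of j] diameter_ge_0[OF bd[of j]]
      by (auto simp: diam_powr_def intro!: ennreal_leI powr_mono2)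
  qed
  also have "\<dots> = ennreal (real (card I) * d powr t)"
    by (simp add: ennreal_mult ennreal_of_nat_eq_real_of_nat)
  finally show ?thesis .
qed

text \<open>A mass distribution principle without measures on \<open>E\<close>: a cover of \<open>E\<close> is pulled back
  to a cover of the unit interval.\<close>

lemma hausdorff_measure_nonzero_if_holder_inverse:
  fixes g :: "real \<Rightarrow> 'a::metric_space"
  assumes t: "t \<ge> 0" and C: "C > 0" and gE: "\<And>z. z \<in> {0..<1} \<Longrightarrow> g z \<in> E"
    and holder: "\<And>z w. z \<in> {0..<1} \<Longrightarrow> w \<in> {0..<1} \<Longrightarrow> \<bar>z - w\<bar> \<le> C * dist (g z) (g w) powr t"
  shows "hausdorff_measure t E \<noteq> 0"
proof
  assume 0: "hausdorff_measure t E = 0"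
  have "hausdorff_premeasure t 1 E \<le> hausdorff_measure t E"
    unfolding hausdorff_measure_def by (rule SUP_upper) auto
  also have "\<dots> < ennreal (1 / (4 * C))" using 0 C by simp
  finally obtain U where U: "U \<in> delta_covers 1 E"
    and lt: "(\<Sum>i. diam_powr t (U i)) < ennreal (1 / (4 * C))"
    unfolding hausdorff_premeasure_def INF_less_iff by blast
  have "\<exists>J. J \<in> sets lborel \<and> {z \<in> {0..<1}. g z \<in> U i} \<subseteq> J \<and>
            emeasure lborel J \<le> ennreal (2 * C) * diam_powr t (U i)" for i
  proof (cases "{z \<in> {0..<1}. g z \<in> U i} = {}")
    case True
    then show ?thesis by (intro exI[of _ "{}"]) auto
  next
    case False
    then obtain w where w: "w \<in> {0..<1}" "g w \<in> U i" by auto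
    define r where "r = (if t = 0 then 1 else diameter (U i) powr t)"
    have bd: "bounded (U i)" using U by (auto simp: delta_covers_def)
    have r: "diam_powr t (U i) = ennreal r" "0 \<le> r"
      using w by (auto simp: diam_powr_def r_def)
    have "\<bar>z - w\<bar> \<le> C * r" if z: "z \<in> {0..<1}" "g z \<in> U i" for z
    proof -
      have "dist (g z) (g w) powr t \<le> r"
        using t diameter_bounded_bound[OF bd z(2) w(2)]
        by (auto simp: r_def intro: powr_mono2)
      then show ?thesis
        using holder[OF z(1) w(1)] C by (meson mult_left_mono less_imp_le order_trans)
    qed
    then have "{z \<in> {0..<1}. g z \<in> U i} \<subseteq> {w - C * r .. w + C * r}"
      by (force simp: abs_le_iff)
    moreover have "emeasure lborel {w - C * r .. w + C * r} = ennreal (2 * C) * diam_powr t (U i)"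
      using r C by (simp add: ennreal_mult'[symmetric])
    ultimately show ?thesis by (intro exI[of _ "{w - C * r .. w + C * r}"]) auto
  qed
  then obtain J where J: "\<And>i. J i \<in> sets lborel"
      "\<And>i. {z \<in> {0..<1}. g z \<in> U i} \<subseteq> J i"
      "\<And>i. emeasure lborel (J i) \<le> ennreal (2 * C) * diam_powr t (U i)"
    by metis
  have "{0..<1} \<subseteq> (\<Union>i. J i)"
  proof
    fix z :: real assume z: "z \<in> {0..<1}"
    then obtain i where "g z \<in> U i"
      using gE[OF z] U by (auto simp: delta_covers_def)
    then show "z \<in> (\<Union>i. J i)" using J(2)[of i] z by auto
  qed
  then have "emeasure lborel {0..<1::real} \<le> emeasure lborel (\<Union>i. J i)"
    using J(1) by (intro emeasure_mono) auto
  also have "\<dots> \<le> (\<Sum>i. emeasure lborel (J i))"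
    using J(1) by (intro emeasure_subadditive_countably) auto
  also have "\<dots> \<le> (\<Sum>i. ennreal (2 * C) * diam_powr t (U i))"
    using J(3) by (intro suminf_le) auto
  also have "\<dots> = ennreal (2 * C) * (\<Sum>i. diam_powr t (U i))"
    by (rule ennreal_suminf_cmult)
  also have "\<dots> \<le> ennreal (2 * C) * ennreal (1 / (4 * C))"
    using lt by (intro mult_left_mono) auto
  also have "\<dots> = ennreal (1 / 2)"
    using C by (simp add: ennreal_mult'[symmetric])
  finally have "ennreal 1 \<le> ennreal (1 / 2)" by simp
  then show False by (subst (asm) ennreal_le_iff) auto
qed

section \<open>Continued fractions\<close>

lemma gauss_map_eq: "gauss_map x = 1 / x - of_int \<lfloor>1 / x\<rfloor>"
  by (simp add: gauss_map_def frac_def)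

lemma gauss_map_bounds: "0 \<le> gauss_map x" "gauss_map x < 1"
  by (simp_all add: gauss_map_def frac_lt_1)

lemma gauss_map_pow_irrational:
  assumes "x \<notin> \<rat>"
  shows "(gauss_map ^^ n) x \<notin> \<rat>"
proof (induction n)
  case (Suc n)
  have "y \<in> \<rat>" if "gauss_map y \<in> \<rat>" for y
  proof -
    have "1 / y = gauss_map y + of_int \<lfloor>1 / y\<rfloor>" by (simp add: gauss_map_eq)
    then have "1 / y \<in> \<rat>" using that by (metis Rats_add Rats_of_int)
    then have "inverse (1 / y) \<in> \<rat>" by (rule Rats_inverse)
    then show ?thesis by simp
  qed
  then show ?case using Suc by auto
qed (use assms in auto)

lemma gauss_map_pow_mem:
  assumes "x \<in> {0..<1}" "x \<notin> \<rat>"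
  shows "(gauss_map ^^ n) x \<in> {0<..<1}"
proof -
  have "(gauss_map ^^ n) x \<in> {0..<1}"
    using assms by (cases n) (auto simp: gauss_map_bounds)
  moreover have "(gauss_map ^^ n) x \<noteq> 0"
    using gauss_map_pow_irrational[OF assms(2), of n] by auto
  ultimately show ?thesis by auto
qed

text \<open>The Gauss map sends \<open>p / q\<close> to \<open>(q mod p) / p\<close>, so the denominators of a rational orbit
  that avoids 0 would decrease forever.\<close>

lemma irrational_if_gauss_orbit_nonzero:
  assumes "\<And>n. (gauss_map ^^ n) x \<in> {0<..<1}"
  shows "x \<notin> \<rat>"
proof
  assume "x \<in> \<rat>"
  have False if "\<And>n. (gauss_map ^^ n) y \<in> {0<..<1}" "y = real p / real q" for y p q
    using that
  proof (induction q arbitrary: y p rule: less_induct)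
    case (less q)
    have y: "0 < y" "y < 1" using less.prems(1)[of 0] by auto
    then have pq: "0 < p" "p < q"
      using less.prems(2) by (auto simp: zero_less_divide_iff field_simps split: if_splits)
    have "gauss_map y = real q / real p - of_int \<lfloor>real q / real p\<rfloor>"
      using less.prems(2) by (simp add: gauss_map_eq)
    also have "\<lfloor>real q / real p\<rfloor> = int (q div p)"
      by (rule floor_divide_of_nat_eq)
    also have "real q / real p - of_int (int (q div p)) = real (q mod p) / real p"
    proof -
      have "real q = real (q div p) * real p + real (q mod p)"
        by (metis div_mult_mod_eq of_nat_add of_nat_mult)
      then show ?thesis using pq by (simp add: field_simps)
    qed
    finally show ?case
      using less.IH[OF pq(2)] less.prems(1) by (metis comp_apply funpow_Suc_right)
  qed
  moreover obtain p q where "\<bar>x\<bar> = real p / real q"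
    using \<open>x \<in> \<rat>\<close> by (rule Rats_abs_nat_div_natE)
  moreover have "\<bar>x\<bar> = x" using assms[of 0] by auto
  ultimately show False using assms by metis
qed

lemma abs_diff_gauss_map:
  assumes "x > 0" "y > 0" "\<lfloor>1 / x\<rfloor> = \<lfloor>1 / y\<rfloor>"
  shows "\<bar>x - y\<bar> = \<bar>gauss_map x - gauss_map y\<bar> * (x * y)"
proof -
  have "gauss_map x - gauss_map y = (y - x) / (x * y)"
    using assms by (simp add: gauss_map_eq field_simps)
  then show ?thesis using assms by (simp add: abs_mult)
qed

lemma abs_diff_gauss_map_pow:
  assumes "\<And>k. (gauss_map ^^ k) x > 0" "\<And>k. (gauss_map ^^ k) y > 0"
    and "\<And>k. k \<in> {1..n} \<Longrightarrow> partial_quotient k x = partial_quotient k y"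
  shows "\<bar>x - y\<bar> = \<bar>(gauss_map ^^ n) x - (gauss_map ^^ n) y\<bar> *
           (\<Prod>k<n. (gauss_map ^^ k) x * (gauss_map ^^ k) y)"
  using assms(3)
proof (induction n)
  case (Suc n)
  have "\<lfloor>1 / (gauss_map ^^ n) x\<rfloor> = \<lfloor>1 / (gauss_map ^^ n) y\<rfloor>"
    using Suc.prems[of "Suc n"] by (simp add: partial_quotient_def)
  note * = abs_diff_gauss_map[OF assms(1,2) this]
  show ?case using Suc by (simp add: * algebra_simps)
qed simp

fun cf_convergent :: "(nat \<Rightarrow> nat) \<Rightarrow> nat \<Rightarrow> real" where
  "cf_convergent a 0 = 0"
| "cf_convergent a (Suc n) = 1 / (real (a 0) + cf_convergent (\<lambda>k. a (Suc k)) n)"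

lemma cf_convergent_bounds:
  assumes "\<And>k. a k \<ge> 2"
  shows "0 \<le> cf_convergent a n" "cf_convergent a n \<le> 1 / 2"
proof -
  have "0 \<le> cf_convergent a n \<and> cf_convergent a n \<le> 1 / 2"
    using assms
  proof (induction n arbitrary: a)
    case (Suc n)
    have "0 \<le> cf_convergent (\<lambda>k. a (Suc k)) n"
      using Suc.IH[of "\<lambda>k. a (Suc k)"] Suc.prems by simp
    moreover have "real (a 0) \<ge> 2" using Suc.prems[of 0] by linarith
    ultimately show ?case by (simp add: field_simps)
  qed simp
  then show "0 \<le> cf_convergent a n" "cf_convergent a n \<le> 1 / 2" by auto
qed

lemma cf_convergent_diff:
  assumes "\<And>k. a k \<ge> 2"
  shows "\<bar>cf_convergent a (n + m) - cf_convergent a n\<bar> \<le> (1 / 4) ^ n"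
  using assms
proof (induction n arbitrary: a)
  case 0
  then show ?case using cf_convergent_bounds[of a m] by simp
next
  case (Suc n)
  let ?b = "\<lambda>k. a (Suc k)"
  define u v where "u = cf_convergent ?b (n + m)" and "v = cf_convergent ?b n"
  have b: "\<And>k. ?b k \<ge> 2" using Suc.prems by simp
  have uv: "\<bar>u - v\<bar> \<le> (1 / 4) ^ n" "0 \<le> u" "0 \<le> v"
    using Suc.IH[OF b] cf_convergent_bounds[OF b] by (auto simp: u_def v_def)
  have a: "real (a 0) \<ge> 2" using Suc.prems[of 0] by linarith
  have "1 / (real (a 0) + u) - 1 / (real (a 0) + v) = (v - u) / ((real (a 0) + u) * (real (a 0) + v))"
    using a uv by (simp add: field_simps)
  then have "\<bar>1 / (real (a 0) + u) - 1 / (real (a 0) + v)\<bar> = \<bar>u - v\<bar> / ((real (a 0) + u) * (real (a 0) + v))"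
    using a uv by (simp add: abs_minus_commute)
  also have "\<dots> \<le> (1 / 4) ^ n / (2 * 2)"
    using a uv by (intro frac_le mult_mono) auto
  finally show ?case by (simp add: u_def v_def)
qed

lemma cf_convergent_convergent:
  assumes "\<And>k. a k \<ge> 2"
  shows "convergent (cf_convergent a)"
proof -
  have "Cauchy (cf_convergent a)"
  proof (rule metric_CauchyI)
    fix e :: real assume e: "e > 0"
    obtain M where M: "(1 / 4 :: real) ^ M < e / 2"
      using real_arch_pow_inv[of "e / 2" "1 / 4"] e by auto
    have *: "dist (cf_convergent a m) (cf_convergent a M) < e / 2" if "m \<ge> M" for m
      using cf_convergent_diff[of a M "m - M"] assms M that by (simp add: dist_real_def)
    show "\<exists>M. \<forall>m\<ge>M. \<forall>n\<ge>M. dist (cf_convergent a m) (cf_convergent a n) < e"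
      using * dist_triangle_half_l by blast
  qed
  then show ?thesis by (simp add: Cauchy_convergent_iff)
qed

text \<open>Digits are indexed from 1 in \<open>partial_quotient\<close>, but from 0 in \<open>cf_convergent\<close>.\<close>

lemma ex_partial_quotients:
  assumes "\<And>k. k \<ge> 1 \<Longrightarrow> a k \<ge> 2"
  shows "\<exists>x. x \<in> {0<..<1} \<and> x \<notin> \<rat> \<and> (\<forall>k\<ge>1. partial_quotient k x = int (a k))"
proof -
  define X where "X m = lim (cf_convergent (\<lambda>k. a (Suc (m + k))))" for m
  have lim: "cf_convergent (\<lambda>k. a (Suc (m + k))) \<longlonglongrightarrow> X m" for m
    unfolding X_def using cf_convergent_convergent[of "\<lambda>k. a (Suc (m + k))"] assms
    by (simp add: convergent_LIMSEQ_iff)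
  have X_bounds: "0 \<le> X m" "X m \<le> 1 / 2" for m
  proof -
    have "\<And>k. a (Suc (m + k)) \<ge> 2" using assms by simp
    note * = cf_convergent_bounds[of "\<lambda>k. a (Suc (m + k))", OF this]
    show "0 \<le> X m" using *(1) by (intro LIMSEQ_le_const[OF lim]) auto
    show "X m \<le> 1 / 2" using *(2) by (intro LIMSEQ_le_const2[OF lim]) auto
  qed
  have X_rec: "X m = 1 / (real (a (Suc m)) + X (Suc m))" for m
  proof (rule LIMSEQ_unique)
    show "(\<lambda>n. cf_convergent (\<lambda>k. a (Suc (m + k))) (Suc n)) \<longlonglongrightarrow> X m"
      using lim by (rule LIMSEQ_Suc)
    have "a (Suc m) \<ge> 2" using assms by simp
    then have "real (a (Suc m)) + X (Suc m) \<noteq> 0" using X_bounds(1)[of "Suc m"] by linarith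
    then have "(\<lambda>n. 1 / (real (a (Suc m)) + cf_convergent (\<lambda>k. a (Suc (Suc m + k))) n))
        \<longlonglongrightarrow> 1 / (real (a (Suc m)) + X (Suc m))"
      by (intro tendsto_intros lim)
    then show "(\<lambda>n. cf_convergent (\<lambda>k. a (Suc (m + k))) (Suc n))
        \<longlonglongrightarrow> 1 / (real (a (Suc m)) + X (Suc m))"
      by simp
  qed
  have X_pos: "0 < X m" for m
  proof -
    have "a (Suc m) \<ge> 2" using assms by simp
    then have "0 < real (a (Suc m)) + X (Suc m)" using X_bounds(1)[of "Suc m"] by linarith
    then show ?thesis by (subst X_rec) simp
  qed
  have inv: "1 / X m = real (a (Suc m)) + X (Suc m)" for m
    by (subst X_rec) simp
  have floor: "\<lfloor>1 / X m\<rfloor> = int (a (Suc m))" for m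
    unfolding inv using X_bounds[of "Suc m"] by (intro floor_unique) auto
  have "gauss_map (X m) = X (Suc m)" for m
    unfolding gauss_map_eq floor by (simp add: inv)
  then have orbit: "(gauss_map ^^ m) (X 0) = X m" for m
    by (induction m) auto
  have mem: "(gauss_map ^^ m) (X 0) \<in> {0<..<1}" for m
    unfolding orbit using X_pos[of m] X_bounds(2)[of m] by simp
  have "partial_quotient k (X 0) = int (a k)" if "k \<ge> 1" for k
    unfolding partial_quotient_def orbit floor using that by simp
  then show ?thesis
    using mem[of 0] irrational_if_gauss_orbit_nonzero[OF mem] by (intro exI[of _ "X 0"]) auto
qed

section \<open>Mixed radix expansions\<close>

fun radix_rem :: "(nat \<Rightarrow> nat) \<Rightarrow> real \<Rightarrow> nat \<Rightarrow> real" where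
  "radix_rem s z 0 = z"
| "radix_rem s z (Suc n) = frac (real (s (Suc n)) * radix_rem s z n)"

definition radix_digit :: "(nat \<Rightarrow> nat) \<Rightarrow> real \<Rightarrow> nat \<Rightarrow> nat" where
  "radix_digit s z n = nat \<lfloor>real (s n) * radix_rem s z (n - 1)\<rfloor>"

lemma radix_rem_bounds:
  assumes "z \<in> {0..<1}"
  shows "0 \<le> radix_rem s z n" "radix_rem s z n < 1"
  using assms by (cases n; simp add: frac_lt_1)+

lemma radix_rem_Suc:
  assumes "z \<in> {0..<1}" "s (Suc n) > 0"
  shows "radix_rem s z n = (real (radix_digit s z (Suc n)) + radix_rem s z (Suc n)) / real (s (Suc n))"
proof -
  have "0 \<le> real (s (Suc n)) * radix_rem s z n"
    using radix_rem_bounds[OF assms(1)] by simp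
  then show ?thesis using assms by (simp add: radix_digit_def frac_def)
qed

lemma radix_digit_less:
  assumes "z \<in> {0..<1}" "s k > 0"
  shows "radix_digit s z k < s k"
proof -
  have "real (s k) * radix_rem s z (k - 1) < real (s k) * 1"
    using radix_rem_bounds[OF assms(1)] assms(2) by (intro mult_strict_left_mono) auto
  then show ?thesis
    using assms(2) radix_rem_bounds(1)[OF assms(1)]
    by (simp add: radix_digit_def nat_less_iff floor_less_iff)
qed

lemma abs_diff_radix_rem:
  assumes z: "z \<in> {0..<1}" and w: "w \<in> {0..<1}" and s: "\<And>k. k \<ge> 1 \<Longrightarrow> s k > 0"
    and eq: "\<And>k. k \<in> {1..n} \<Longrightarrow> radix_digit s z k = radix_digit s w k"
  shows "\<bar>z - w\<bar> = \<bar>radix_rem s z n - radix_rem s w n\<bar> / (\<Prod>k=1..n. real (s k))"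
  using eq
proof (induction n)
  case (Suc n)
  have sn: "s (Suc n) > 0" using s by simp
  have "radix_rem s z n - radix_rem s w n =
      (radix_rem s z (Suc n) - radix_rem s w (Suc n)) / real (s (Suc n))"
    using Suc.prems[of "Suc n"]
    by (simp add: radix_rem_Suc[of z s n, OF z sn] radix_rem_Suc[of w s n, OF w sn]
        diff_divide_distrib[symmetric] del: radix_rem.simps)
  then have "\<bar>radix_rem s z n - radix_rem s w n\<bar> =
      \<bar>radix_rem s z (Suc n) - radix_rem s w (Suc n)\<bar> / real (s (Suc n))"
    by simp
  then show ?case using Suc by (simp add: mult.commute del: radix_rem.simps)
qed simp

section \<open>Growth of the products\<close>

lemma prod_superexponential:
  fixes s :: "nat \<Rightarrow> nat"
  assumes lim: "filterlim s at_top sequentially" and s: "\<And>n. n \<ge> 1 \<Longrightarrow> s n \<ge> 1"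
  shows "\<exists>B. \<forall>n. K * real n \<le> ln (\<Prod>k=1..n. real (s k)) + B"
proof -
  define L where "L n = ln (\<Prod>k=1..n. real (s k))" for n
  have s1: "real (s (Suc n)) \<ge> 1" for n
    using s[of "Suc n"] by linarith
  have P1: "(\<Prod>k=1..n. real (s k)) > 0" for n
    using s by (intro prod_pos) (auto simp: Suc_le_eq)
  have LS: "L (Suc n) = L n + ln (real (s (Suc n)))" for n
    using P1[of n] s1[of n] by (simp add: L_def ln_mult_pos)
  have "filterlim (\<lambda>n. ln (real (s n))) at_top sequentially"
    by (intro filterlim_compose[OF ln_at_top] filterlim_compose[OF filterlim_real_sequentially] lim)
  then obtain m where m: "\<And>k. k \<ge> m \<Longrightarrow> ln (real (s k)) \<ge> \<bar>K\<bar>"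
    by (auto simp: filterlim_at_top eventually_sequentially)
  have "\<bar>K\<bar> * real n \<le> L n + \<bar>K\<bar> * real m" for n
  proof (induction n)
    case 0
    then show ?case by (simp add: L_def)
  next
    case (Suc n)
    show ?case
    proof (cases "Suc n \<ge> m")
      case True
      then show ?thesis using Suc m[of "Suc n"] LS[of n] by (simp add: algebra_simps)
    next
      case False
      have "L n \<ge> 0" for n
        using s1 by (induction n) (auto simp: LS, simp add: L_def)
      then have "0 \<le> L (Suc n)" .
      moreover have "\<bar>K\<bar> * real (Suc n) \<le> \<bar>K\<bar> * real m"
        using False by (intro mult_left_mono) auto
      ultimately show ?thesis by linarith
    qed
  qed
  moreover have "K * real n \<le> \<bar>K\<bar> * real n" for n
    by (intro mult_right_mono) auto
  ultimately show ?thesis unfolding L_def by (meson order_trans)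
qed


section \<open>The dimension of the digit set\<close>

definition digit_set :: "(nat \<Rightarrow> nat) \<Rightarrow> real \<Rightarrow> real set" where
  "digit_set s N = {x. x \<in> {0..<1} \<and> x \<notin> \<rat> \<and>
     (\<forall>n\<ge>1. real (s n) \<le> real_of_int (partial_quotient n x) \<and>
             real_of_int (partial_quotient n x) < N * real (s n))}"

lemma gauss_map_pow_le:
  assumes "(gauss_map ^^ k) x > 0" "b > 0" "b \<le> real_of_int (partial_quotient (Suc k) x)"
  shows "(gauss_map ^^ k) x \<le> 1 / b"
proof -
  have "b \<le> 1 / (gauss_map ^^ k) x"
    using assms(3) of_int_floor_le[of "1 / (gauss_map ^^ k) x"] by (simp only: partial_quotient_def diff_Suc_1 order_trans)
  then show ?thesis using assms(1,2) by (simp add: field_simps)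
qed

lemma gauss_map_pow_ge:
  assumes "(gauss_map ^^ k) x > 0" "real_of_int (partial_quotient (Suc k) x) + 1 \<le> b"
  shows "1 / b \<le> (gauss_map ^^ k) x"
proof -
  have "1 / (gauss_map ^^ k) x \<le> b"
    using assms(2) by (simp add: partial_quotient_def) linarith
  moreover from this have "b > 0"
    using assms(1) by (smt (verit) divide_pos_pos)
  ultimately show ?thesis using assms(1) by (simp add: field_simps)
qed

lemma hausdorff_measure_digit_set_eq_0:
  fixes s :: "nat \<Rightarrow> nat" and N t r :: real
  defines "L \<equiv> \<lambda>n. ln (\<Prod>k=1..n. real (s k))"
  defines "D \<equiv> \<lambda>n. 2 * L n + ln (real (s (n + 1)))"
  assumes lim: "filterlim s at_top sequentially" and s: "\<And>n. n \<ge> 1 \<Longrightarrow> s n \<ge> 2"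
    and N: "N \<ge> 1" and t: "0 \<le> r" "r < t"
    and freq: "\<exists>\<^sub>F n in sequentially. L n / D n < r"
  shows "hausdorff_measure t (digit_set s N) = 0"
proof -
  have s1: "\<And>k. k \<ge> 1 \<Longrightarrow> s k \<ge> 1" using s by (meson one_le_numeral order_trans)
  have P1: "(\<Prod>k=1..n. real (s k)) \<ge> 1" for n
    using s1 by (intro prod_ge_1) (metis atLeastAtMost_iff of_nat_1 of_nat_le_iff)
  have L0: "L n \<ge> 0" for n using P1 by (simp add: L_def)
  have expL: "exp (L n) = (\<Prod>k=1..n. real (s k))" for n
    using P1[of n] by (simp add: L_def)
  have sn: "real (s (Suc n)) \<ge> 2" for n using s[of "Suc n"] by simp
  have DL: "L n \<le> D n" "D n > 0" for n
  proof -
    have "ln (real (s (n + 1))) > 0" using sn[of n] by simp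
    then show "L n \<le> D n" "D n > 0" using L0[of n] by (simp_all add: D_def)
  qed
  have expD: "exp (- D n) = 1 / ((\<Prod>k=1..n. real (s k))\<^sup>2 * real (s (n + 1)))" for n
  proof -
    have "exp (D n) = exp (L n) ^ 2 * real (s (n + 1))"
      using sn[of n] by (simp add: D_def exp_add exp_double)
    then show ?thesis by (simp add: exp_minus expL field_simps)
  qed
  obtain B1 where B1: "\<And>n. 1 * real n \<le> L n + B1"
    using prod_superexponential[OF lim s1, of 1] unfolding L_def by auto
  obtain B where B: "\<And>n. ((ln N + 1) / (t - r)) * real n \<le> L n + B"
    using prod_superexponential[OF lim s1, of "(ln N + 1) / (t - r)"] unfolding L_def by auto
  have small: "hausdorff_premeasure t \<delta> (digit_set s N) \<le> ennreal e"
    if \<delta>: "\<delta> > 0" and e: "e > 0" for \<delta> e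
  proof -
    have "\<forall>\<^sub>F n in sequentially. real n \<ge> B1 - ln \<delta> \<and> real n \<ge> (t - r) * B - ln e"
      using filterlim_real_sequentially by (auto simp: filterlim_at_top intro!: eventually_conj)
    with freq have "\<exists>\<^sub>F n in sequentially. L n / D n < r \<and>
        real n \<ge> B1 - ln \<delta> \<and> real n \<ge> (t - r) * B - ln e"
      by (auto intro: frequently_eventually_frequently)
    then obtain n where n: "L n / D n < r" "real n \<ge> B1 - ln \<delta>" "real n \<ge> (t - r) * B - ln e"
      by (auto dest: frequently_ex)
    define A where "A k = {i :: int. real (s k) \<le> of_int i \<and> of_int i < N * real (s k)}" for k
    define I where "I = PiE {1..n} A"
    define V where "V w = {x \<in> digit_set s N. \<forall>k\<in>{1..n}. partial_quotient k x = w k}" for w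
    have A: "finite (A k)" "real (card (A k)) \<le> N * real (s k)" if "k \<ge> 1" for k
    proof -
      have Asub: "A k \<subseteq> {int (s k)..<\<lceil>N * real (s k)\<rceil>}"
        by (auto simp: A_def less_ceiling_iff)
      then show "finite (A k)" by (rule finite_subset) auto
      have "card (A k) \<le> nat (\<lceil>N * real (s k)\<rceil> - int (s k))"
        using card_mono[OF _ Asub] by simp
      moreover have "real (s k) \<ge> 1" using s1[OF that] by simp
      moreover have "1 * real (s k) \<le> N * real (s k)" using N by (intro mult_right_mono) auto
      ultimately show "real (card (A k)) \<le> N * real (s k)" by linarith
    qed
    have cardI: "real (card I) \<le> N ^ n * exp (L n)"
    proof -
      have "real (card I) = (\<Prod>k=1..n. real (card (A k)))"
        by (simp add: I_def card_PiE)
      also have "\<dots> \<le> (\<Prod>k=1..n. N * real (s k))"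
        using A by (intro prod_mono) auto
      also have "\<dots> = N ^ n * exp (L n)" by (simp add: prod.distrib expL)
      finally show ?thesis .
    qed
    have diam: "dist x y \<le> exp (- D n)" if x: "x \<in> V w" and y: "y \<in> V w" for w x y
    proof -
      have pos: "(gauss_map ^^ k) x > 0" "(gauss_map ^^ k) y > 0" for k
        using gauss_map_pow_mem x y by (auto simp: V_def digit_set_def)
      have le: "(gauss_map ^^ k) x \<le> 1 / real (s (Suc k))" "(gauss_map ^^ k) y \<le> 1 / real (s (Suc k))" for k
        using x y sn[of k] by (auto intro!: gauss_map_pow_le pos simp: V_def digit_set_def)
      have "dist x y = \<bar>(gauss_map ^^ n) x - (gauss_map ^^ n) y\<bar> *
           (\<Prod>k<n. (gauss_map ^^ k) x * (gauss_map ^^ k) y)"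
        using abs_diff_gauss_map_pow[OF pos, of n] x y by (simp add: V_def dist_real_def)
      also have "\<dots> \<le> 1 / real (s (Suc n)) * (\<Prod>k<n. 1 / real (s (Suc k)) * (1 / real (s (Suc k))))"
      proof (rule mult_mono)
        show "\<bar>(gauss_map ^^ n) x - (gauss_map ^^ n) y\<bar> \<le> 1 / real (s (Suc n))"
          using pos[of n] le[of n] by linarith
        show "(\<Prod>k<n. (gauss_map ^^ k) x * (gauss_map ^^ k) y)
            \<le> (\<Prod>k<n. 1 / real (s (Suc k)) * (1 / real (s (Suc k))))"
          using pos le by (intro prod_mono conjI mult_mono mult_nonneg_nonneg) (auto intro: less_imp_le)
        show "0 \<le> (\<Prod>k<n. (gauss_map ^^ k) x * (gauss_map ^^ k) y)"
          using pos by (intro prod_nonneg mult_nonneg_nonneg) (auto intro: less_imp_le)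
      qed simp
      also have "\<dots> = exp (- D n)"
        by (simp add: expD prod.atLeast1_atMost_eq prod_dividef prod.distrib power2_eq_square)
      finally show ?thesis .
    qed
    have "digit_set s N \<subseteq> (\<Union>w\<in>I. V w)"
    proof
      fix x assume x: "x \<in> digit_set s N"
      then have "restrict (\<lambda>k. partial_quotient k x) {1..n} \<in> I"
        by (auto simp: I_def A_def digit_set_def)
      then show "x \<in> (\<Union>w\<in>I. V w)"
        using x by (intro UN_I) (auto simp: V_def)
    qed
    moreover have "finite I" unfolding I_def using A by (intro finite_PiE) auto
    moreover have "exp (- D n) \<le> \<delta>"
    proof -
      have "- D n \<le> ln \<delta>" using DL(1)[of n] B1[of n] n(2) by linarith
      then show ?thesis using \<delta> by (simp add: ln_ge_iff)
    qed
    ultimately have "hausdorff_premeasure t \<delta> (digit_set s N) \<le> ennreal (real (card I) * exp (- D n) powr t)"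
      using diam t by (intro hausdorff_premeasure_le_finite_cover[where V = V]) auto
    also have "\<dots> \<le> ennreal e"
    proof (rule ennreal_leI)
      have "real (card I) * exp (- D n) powr t \<le> (N ^ n * exp (L n)) * exp (- D n) powr t"
        using cardI by (rule mult_right_mono) simp
      also have "\<dots> = exp (real n * ln N + L n - t * D n)"
      proof -
        have "exp (- D n) powr t = exp (- (t * D n))" by (simp add: powr_def)
        moreover have "N ^ n = exp (real n * ln N)" using N by (simp add: exp_of_nat_mult)
        ultimately show ?thesis by (simp add: exp_add exp_diff exp_minus divide_inverse)
      qed
      also have "real n * ln N + L n - t * D n \<le> ln e"
      proof -
        have "L n \<le> r * D n" using n(1) DL(2)[of n] by (simp add: field_simps)
        moreover have "(t - r) * (((ln N + 1) / (t - r)) * real n) \<le> (t - r) * (D n + B)"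
          using t B[of n] DL(1)[of n] by (intro mult_left_mono) auto
        then have "(ln N + 1) * real n \<le> (t - r) * (D n + B)" using t by simp
        ultimately show ?thesis using n(3) by (simp add: algebra_simps)
      qed
      finally show "real (card I) * exp (- D n) powr t \<le> e" using e by simp
    qed
    finally show ?thesis .
  qed
  have "hausdorff_premeasure t \<delta> (digit_set s N) = 0" if "\<delta> > 0" for \<delta>
  proof -
    have "hausdorff_premeasure t \<delta> (digit_set s N) \<le> 0"
      by (rule ennreal_le_epsilon) (use small[OF that] in auto)
    then show ?thesis by simp
  qed
  then show ?thesis by (simp add: hausdorff_measure_def)
qed

lemma bounded_above_if_eventually:
  fixes u :: "nat \<Rightarrow> real"
  assumes "\<forall>\<^sub>F n in sequentially. u n \<le> c"
  shows "\<exists>b. \<forall>n. u n \<le> b"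
proof -
  obtain m where m: "\<And>n. n \<ge> m \<Longrightarrow> u n \<le> c"
    using assms by (auto simp: eventually_sequentially)
  have "u n \<le> max c (Max (u ` {..m}))" for n
    using m[of n] by (cases "n \<ge> m") (auto simp: le_max_iff_disj)
  then show ?thesis by blast
qed

lemma hausdorff_measure_digit_set_nonzero:
  fixes s :: "nat \<Rightarrow> nat" and N t r :: real
  defines "L \<equiv> \<lambda>n. ln (\<Prod>k=1..n. real (s k))"
  defines "D \<equiv> \<lambda>n. 2 * L n + ln (real (s (n + 1)))"
  assumes lim: "filterlim s at_top sequentially" and s: "\<And>n. n \<ge> 1 \<Longrightarrow> s n \<ge> 3"
    and N: "N \<ge> 2" and t: "0 \<le> t" "t < r" "t \<le> 1"
    and ev: "\<forall>\<^sub>F n in sequentially. r \<le> L n / D n"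
  shows "hausdorff_measure t (digit_set s N) \<noteq> 0"
proof -
  have s1: "\<And>k. k \<ge> 1 \<Longrightarrow> s k \<ge> 1" using s by (meson one_le_numeral order_trans)
  have s0: "\<And>k. k \<ge> 1 \<Longrightarrow> s k > 0" using s1 by (simp add: Suc_le_eq)
  have P1: "(\<Prod>k=1..n. real (s k)) \<ge> 1" for n
    using s1 by (intro prod_ge_1) (metis atLeastAtMost_iff of_nat_1 of_nat_le_iff)
  have L0: "L n \<ge> 0" for n using P1 by (simp add: L_def)
  have expL: "exp (L n) = (\<Prod>k=1..n. real (s k))" for n
    using P1[of n] by (simp add: L_def)
  have sn: "real (s (Suc n)) \<ge> 3" for n using s[of "Suc n"] by simp
  have DL: "L n \<le> D n" "D n > 0" for n
  proof -
    have "ln (real (s (n + 1))) > 0" using sn[of n] by simp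
    then show "L n \<le> D n" "D n > 0" using L0[of n] by (simp_all add: D_def)
  qed
  have expD: "exp (D n) = exp (L n) ^ 2 * real (s (Suc n))" for n
    using sn[of n] by (simp add: D_def exp_add exp_double)
  have "\<exists>c. \<forall>n. t * (ln 6 + real n * ln 4 + D n) + ln 2 - L n \<le> c"
  proof -
    obtain B where B: "\<And>n. (t * ln 4 / (r - t)) * real n \<le> L n + B"
      using prod_superexponential[OF lim s1, of "t * ln 4 / (r - t)"] unfolding L_def by auto
    have "t * (ln 6 + real n * ln 4 + D n) + ln 2 - L n \<le> t * ln 6 + ln 2 + (r - t) * B"
      if "r \<le> L n / D n" for n
    proof -
      have "r * D n \<le> L n" using that DL(2)[of n] by (simp add: field_simps)
      moreover have "(r - t) * ((t * ln 4 / (r - t)) * real n) \<le> (r - t) * (D n + B)"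
        using t B[of n] DL(1)[of n] by (intro mult_left_mono) auto
      then have "t * ln 4 * real n \<le> (r - t) * (D n + B)" using t by simp
      ultimately show ?thesis by (simp add: algebra_simps)
    qed
    then show ?thesis
      by (intro bounded_above_if_eventually[where c = "t * ln 6 + ln 2 + (r - t) * B"]
          eventually_mono[OF ev]) auto
  qed
  then obtain c where c: "\<And>n. t * (ln 6 + real n * ln 4 + D n) + ln 2 - L n \<le> c" by blast
  have "\<exists>x. x \<in> {0<..<1} \<and> x \<notin> \<rat> \<and>
      (\<forall>k\<ge>1. partial_quotient k x = int (s k + radix_digit s z k))" for z
    by (rule ex_partial_quotients) (use s in \<open>meson le_add1 numeral_le_iff order_trans semiring_norm\<close>)
  then obtain g where g: "\<And>z. g z \<in> {0<..<1}" "\<And>z. g z \<notin> \<rat>"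
      "\<And>z k. k \<ge> 1 \<Longrightarrow> partial_quotient k (g z) = int (s k + radix_digit s z k)"
    by metis
  have pq: "real_of_int (partial_quotient k (g z)) + 1 \<le> 2 * real (s k)"
    if "z \<in> {0..<1}" "k \<ge> 1" for z k
    using radix_digit_less[where z = z and s = s and k = k] s0 that by (simp add: g(3))
  have g_mem: "g z \<in> digit_set s N" if z: "z \<in> {0..<1}" for z
  proof -
    have "real_of_int (partial_quotient k (g z)) < N * real (s k)" if k: "k \<ge> 1" for k
    proof -
      have "2 * real (s k) \<le> N * real (s k)" using N by (intro mult_right_mono) auto
      then show ?thesis using pq[OF z k] by linarith
    qed
    then show ?thesis
      using g(1,2)[of z] by (auto simp: digit_set_def g(3))
  qed
  have orbit: "(gauss_map ^^ k) (g z) > 0" for k z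
    using gauss_map_pow_mem[of "g z" k] g(1,2)[of z] by auto
  have orbit_ge: "1 / (2 * real (s (Suc k))) \<le> (gauss_map ^^ k) (g z)" if "z \<in> {0..<1}" for k z
    using pq[OF that, of "Suc k"] by (intro gauss_map_pow_ge orbit) auto
  have orbit_le: "(gauss_map ^^ k) (g z) \<le> 1 / 3" for k z
    using sn[of k] by (intro gauss_map_pow_le orbit) (auto simp: g(3))
  show ?thesis
  proof (rule hausdorff_measure_nonzero_if_holder_inverse[where g = g and C = "exp c"])
    fix z w :: real assume z: "z \<in> {0..<1}" and w: "w \<in> {0..<1}"
    show "\<bar>z - w\<bar> \<le> exp c * dist (g z) (g w) powr t"
    proof (cases "\<exists>n. radix_digit s z (Suc n) \<noteq> radix_digit s w (Suc n)")
      case False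
      then have eq: "radix_digit s z k = radix_digit s w k" if "k \<in> {1..n}" for k n
        using that by (cases k) auto
      obtain B where B: "\<And>n. 1 * real n \<le> L n + B"
        using prod_superexponential[OF lim s1, of 1] unfolding L_def by auto
      have "\<bar>z - w\<bar> \<le> exp B * exp (- real n)" for n
      proof -
        have "\<bar>z - w\<bar> = \<bar>radix_rem s z n - radix_rem s w n\<bar> / exp (L n)"
          unfolding expL using eq by (intro abs_diff_radix_rem z w s0) auto
        also have "\<dots> \<le> 1 / exp (L n)"
          using radix_rem_bounds[OF z, of s n] radix_rem_bounds[OF w, of s n]
          by (intro divide_right_mono) auto
        also have "\<dots> = exp (- L n)" by (simp add: exp_minus field_simps)
        also have "\<dots> \<le> exp (B - real n)" using B[of n] by simp
        finally show ?thesis by (simp add: exp_diff exp_minus field_simps)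
      qed
      moreover have "(\<lambda>n. exp B * exp (- real n)) \<longlonglongrightarrow> exp B * 0"
        by (intro tendsto_intros filterlim_compose[OF exp_at_bot]
            filterlim_compose[OF filterlim_uminus_at_bot_at_top] filterlim_real_sequentially)
      ultimately have "\<bar>z - w\<bar> \<le> 0"
        by (intro LIMSEQ_le_const[where X = "\<lambda>n. exp B * exp (- real n)"]) auto
      also have "0 \<le> exp c * dist (g z) (g w) powr t" by simp
      finally show ?thesis .
    next
      case True
      define n where "n = (LEAST n. radix_digit s z (Suc n) \<noteq> radix_digit s w (Suc n))"
      have neq: "radix_digit s z (Suc n) \<noteq> radix_digit s w (Suc n)"
        unfolding n_def using True by (rule LeastI_ex)
      have eq: "radix_digit s z k = radix_digit s w k" if "k \<in> {1..n}" for k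
        using that not_less_Least[of "k - 1" "\<lambda>n. radix_digit s z (Suc n) \<noteq> radix_digit s w (Suc n)"]
        by (auto simp: n_def)
      define q where "q = real (s (Suc n))"
      define j where "j = \<bar>real (radix_digit s z (Suc n)) - real (radix_digit s w (Suc n))\<bar>"
      have q: "q \<ge> 3" using sn by (simp add: q_def)
      have j: "1 \<le> j" "j \<le> q"
        using neq radix_digit_less[OF z, of s "Suc n"] radix_digit_less[OF w, of s "Suc n"] s0
        by (auto simp: j_def q_def)
      have upper: "\<bar>z - w\<bar> \<le> 2 * (j / q) * exp (- L n)"
      proof -
        have sn0: "s (Suc n) > 0" using s0 by simp
        have "\<bar>radix_rem s z n - radix_rem s w n\<bar> \<le> (j + 1) / q"
          using radix_rem_bounds[OF z, of s "Suc n"] radix_rem_bounds[OF w, of s "Suc n"] q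
          unfolding radix_rem_Suc[of z s n, OF z sn0] radix_rem_Suc[of w s n, OF w sn0]
          unfolding diff_divide_distrib[symmetric] abs_divide q_def[symmetric]
          by (simp add: j_def divide_right_mono del: radix_rem.simps)
        also have "\<dots> \<le> 2 * (j / q)" using j q by (simp add: field_simps)
        finally have "\<bar>radix_rem s z n - radix_rem s w n\<bar> / exp (L n) \<le> 2 * (j / q) / exp (L n)"
          by (rule divide_right_mono) simp
        moreover have "\<bar>z - w\<bar> = \<bar>radix_rem s z n - radix_rem s w n\<bar> / exp (L n)"
          unfolding expL using eq by (intro abs_diff_radix_rem z w s0) auto
        ultimately show ?thesis by (simp add: exp_minus divide_inverse)
      qed
      have lower: "j / (6 * 4 ^ n * q * exp (D n)) \<le> dist (g z) (g w)"
      proof -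
        define x y where "x = (gauss_map ^^ n) (g z)" and "y = (gauss_map ^^ n) (g w)"
        have xy: "x > 0" "y > 0" "1 / (2 * q) \<le> x" "1 / (2 * q) \<le> y"
          using orbit orbit_ge[OF z] orbit_ge[OF w] by (auto simp: x_def y_def q_def)
        text \<open>Since all digits are at least 3, the tails cannot compensate the differing digit.\<close>
        have "\<bar>1 / x - 1 / y\<bar> \<ge> 2 / 3 * j"
        proof -
          have inv: "1 / (gauss_map ^^ n) (g v) =
              real (s (Suc n)) + real (radix_digit s v (Suc n)) + (gauss_map ^^ Suc n) (g v)" for v
            using g(3)[of "Suc n" v] by (simp add: gauss_map_eq partial_quotient_def)
          have "\<bar>(gauss_map ^^ Suc n) (g z) - (gauss_map ^^ Suc n) (g w)\<bar> \<le> 1 / 3"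
            using orbit[of "Suc n" z] orbit[of "Suc n" w] orbit_le[of "Suc n" z] orbit_le[of "Suc n" w]
            by linarith
          then have "\<bar>1 / x - 1 / y\<bar> \<ge> j - 1 / 3"
            unfolding x_def y_def inv j_def by linarith
          then show ?thesis using j by linarith
        qed
        then have "(2 / 3 * j) * ((1 / (2 * q)) * (1 / (2 * q))) \<le> \<bar>1 / x - 1 / y\<bar> * (x * y)"
          using xy q j by (intro mult_mono) auto
        also have "\<dots> = \<bar>(1 / x - 1 / y) * (x * y)\<bar>" using xy by (simp add: abs_mult)
        also have "(1 / x - 1 / y) * (x * y) = y - x" using xy by (simp add: field_simps)
        also have "\<bar>y - x\<bar> = \<bar>x - y\<bar>" by simp
        finally have "j / (6 * q\<^sup>2) \<le> \<bar>x - y\<bar>" by (simp add: power2_eq_square)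
        moreover have "1 / (4 ^ n * exp (L n) ^ 2) \<le> (\<Prod>k<n. (gauss_map ^^ k) (g z) * (gauss_map ^^ k) (g w))"
        proof -
          have "1 / (4 ^ n * exp (L n) ^ 2) = (\<Prod>k<n. 1 / (2 * real (s (Suc k))) * (1 / (2 * real (s (Suc k)))))"
            by (simp add: expL prod.atLeast1_atMost_eq prod_dividef prod.distrib power2_eq_square power_mult_distrib[symmetric])
          also have "\<dots> \<le> (\<Prod>k<n. (gauss_map ^^ k) (g z) * (gauss_map ^^ k) (g w))"
            using orbit_ge[OF z] orbit_ge[OF w] orbit
            by (intro prod_mono conjI mult_mono) (auto intro: less_imp_le)
          finally show ?thesis .
        qed
        ultimately have "j / (6 * q\<^sup>2) * (1 / (4 ^ n * exp (L n) ^ 2)) \<le>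
            \<bar>x - y\<bar> * (\<Prod>k<n. (gauss_map ^^ k) (g z) * (gauss_map ^^ k) (g w))"
          using j q by (intro mult_mono) auto
        also have "\<dots> = dist (g z) (g w)"
          using abs_diff_gauss_map_pow[OF orbit orbit, of n z w] g(3) eq
          by (simp add: dist_real_def x_def y_def)
        finally show ?thesis
          by (simp add: expD q_def[symmetric] power2_eq_square mult_ac)
      qed
      have "2 * (j / q) * exp (- L n) \<le> 2 * (j / q) powr t * exp (- L n)"
      proof -
        have "(j / q) powr 1 \<le> (j / q) powr t"
          using j q t by (intro powr_mono') auto
        then have "j / q \<le> (j / q) powr t" using j q by simp
        then show ?thesis by (intro mult_right_mono mult_left_mono) auto
      qed
      also have "\<dots> = (j / q) powr t * exp (ln 2 - L n)"
        by (simp add: exp_diff exp_minus field_simps)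
      also have "\<dots> \<le> (j / q) powr t * exp (c - t * (ln 6 + real n * ln 4 + D n))"
        using c[of n] by (intro mult_left_mono) auto
      also have "\<dots> = exp c * (j / (6 * 4 ^ n * q * exp (D n))) powr t"
      proof -
        have "exp (t * (ln 6 + real n * ln 4 + D n)) = (6 * 4 ^ n * exp (D n)) powr t"
          by (simp add: powr_def ln_mult_pos ln_realpow)
        then have "(j / q) powr t * exp (c - t * (ln 6 + real n * ln 4 + D n)) =
            exp c * ((j / q) powr t / (6 * 4 ^ n * exp (D n)) powr t)"
          by (simp add: exp_diff)
        also have "(j / q) powr t / (6 * 4 ^ n * exp (D n)) powr t = (j / q / (6 * 4 ^ n * exp (D n))) powr t"
          by (rule powr_divide[symmetric])
        finally show ?thesis by (simp add: mult_ac)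
      qed
      also have "\<dots> \<le> exp c * dist (g z) (g w) powr t"
        using lower j q t by (intro mult_left_mono powr_mono2) auto
      finally show ?thesis using upper by linarith
    qed
  qed (use t g_mem in auto)
qed

theorem lemma3p2:
  fixes s :: "nat \<Rightarrow> nat" and N :: real
  assumes "filterlim s at_top sequentially"
    and "\<And>n. n \<ge> 1 \<Longrightarrow> s n \<ge> 3"
    and "N \<ge> 2"
  shows "hausdorff_dim {x::real. x \<in> {0..<1} \<and> x \<notin> \<rat> \<and>
           (\<forall>n\<ge>1. real (s n) \<le> real_of_int (partial_quotient n x) \<and>
                   real_of_int (partial_quotient n x) < N * real (s n))} =
         liminf (\<lambda>n. ereal (ln (\<Prod>k=1..n. real (s k)) /
           (2 * ln (\<Prod>k=1..n. real (s k)) + ln (real (s (n + 1))))))"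
proof -
  define L where "L n = ln (\<Prod>k=1..n. real (s k))" for n
  define D where "D n = 2 * L n + ln (real (s (n + 1)))" for n
  let ?l = "liminf (\<lambda>n. ereal (L n / D n))"
  have s1: "real (s k) \<ge> 1" and s2: "s k \<ge> 2" if "k \<ge> 1" for k
    using assms(2)[OF that] by simp_all
  have L0: "L n \<ge> 0" for n unfolding L_def using s1 by (intro ln_ge_zero prod_ge_1) auto
  have ratio: "0 \<le> L n / D n" "L n / D n \<le> 1" for n
  proof -
    have "ln (real (s (n + 1))) \<ge> 0" using s1[of "n + 1"] by simp
    then have "0 \<le> L n" "L n \<le> D n" using L0[of n] by (simp_all add: D_def)
    then show "0 \<le> L n / D n" "L n / D n \<le> 1" by (auto simp: divide_le_eq_1)
  qed
  have "hausdorff_dim (digit_set s N) = ?l"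
  proof (rule antisym)
    show "hausdorff_dim (digit_set s N) \<le> ?l"
    proof (rule dense_ge)
      fix y assume "?l < y"
      then obtain t where t: "?l < ereal t" "ereal t < y" by (rule ereal_dense2[THEN exE]) auto
      obtain r where r: "?l < ereal r" "ereal r < ereal t" using ereal_dense2[OF t(1)] by auto
      have "0 \<le> ?l" using ratio by (intro Liminf_bounded) auto
      then have "0 \<le> r" using r(1) by (metis ereal_less_eq(5) le_less_trans less_imp_le)
      have "\<exists>\<^sub>F n in sequentially. L n / D n < r"
      proof (rule ccontr)
        assume "\<not> ?thesis"
        then have "\<forall>\<^sub>F n in sequentially. ereal r \<le> ereal (L n / D n)"
          by (simp add: not_frequently not_less)
        then have "ereal r \<le> ?l" by (rule Liminf_bounded)
        then show False using r(1) by simp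
      qed
      then have "hausdorff_measure t (digit_set s N) = 0"
        using assms(1,3) \<open>0 \<le> r\<close> r(2) s2 unfolding L_def D_def
        by (intro hausdorff_measure_digit_set_eq_0[where r = r]) auto
      then have "hausdorff_dim (digit_set s N) \<le> ereal t"
        using \<open>0 \<le> r\<close> r(2) unfolding hausdorff_dim_def by (intro INF_lower) auto
      then show "hausdorff_dim (digit_set s N) \<le> y" using t(2) by simp
    qed
    show "?l \<le> hausdorff_dim (digit_set s N)"
      unfolding hausdorff_dim_def
    proof (rule INF_greatest, rule ccontr)
      fix t assume t: "t \<in> {t. 0 \<le> t \<and> hausdorff_measure t (digit_set s N) = 0}"
        and "\<not> ?l \<le> ereal t"
      then obtain r where r: "ereal t < ereal r" "ereal r < ?l"
        using ereal_dense2[of "ereal t" ?l] by (auto simp: not_le)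
      have ev: "\<forall>\<^sub>F n in sequentially. r \<le> L n / D n"
        using less_LiminfD[OF r(2)] by (auto elim: eventually_mono)
      then obtain n where "r \<le> L n / D n"
        using eventually_happens'[OF sequentially_bot ev] by auto
      then have "t \<le> 1" using r(1) ratio(2)[of n] by simp
      then have "hausdorff_measure t (digit_set s N) \<noteq> 0"
        using assms ev t r(1) unfolding L_def D_def
        by (intro hausdorff_measure_digit_set_nonzero[where r = r]) auto
      then show False using t by simp
    qed
  qed
  then show ?thesis by (simp only: digit_set_def L_def D_def)
qed

end
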